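(* Let $H=\langle m_0,\dots,m_p,n\rangle$ be a numerical semigroup minimally generated by an almost arithmetic sequence, with associated data as in the context, and assume $W\ne\emptyset$. Suppose $r'\ge2$. Then for each $\alpha_i\in\mathrm{PF}_1(H)$, $i\in[p+1,p+r'-1]$, writing $i=p+\theta_i$ with $\theta_i\in[1,r'-1]$, there exists an $\mathrm{RF}$-matrix for $\alpha_i$ whose rows (indexed by $0,1,\dots,p,n$) are: (1) row $0$: $-E_0+q'E_p+(v-1)E_n+E_{\theta_i}$; (2) row $j$ for $j\in[1,2p-i]$: $-E_j+q'E_p+(v-1)E_n+E_{\theta_i+j}$; (3) row $j$ for $j\in[2p-i+1,p]$: $(\nu-1)E_0-E_j+(w-1)E_n+E_{\theta_i+j-r'}$; (4) row $n$: $(\mu-1)E_0+(q'+q_z)E_p-E_n+E_{\theta_i}+E_{r_z}$ if $\mu>0$, and $(q'+q_z)E_p-E_n+E_{\theta_i+r_z}$ if $\mu=0$.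
   Context: Notation: $\mathbb N=\{0,1,2,\dots\}$; $[a,b]$ is the set of integers $i$ with $a\le i\le b$. Let $p\ge1$, $d\ge1$, $m_0\ge 1$ be integers, $m_i=m_0+id$ for $i\in[0,p]$, and $n\ge1$ an integer with $\gcd(m_0,d,n)=1$. Put $H'=\sum_{i=0}^p\mathbb Nm_i$ and $H=H'+\mathbb Nn=\langle m_0,\dots,m_p,n\rangle$; assume $\{m_0,\dots,m_p,n\}$ is a minimal generating set of $H$. $\mathrm{Ap}(H,m_0)=\{h\in H: h-m_0\notin H\}$. For $t\in\mathbb N$ write $t=q_tp+r_t$ with $q_t\in\mathbb Z$, $r_t\in[1,p]$, and set $g_t=q_tm_p+m_{r_t}$ (so $q_0=-1$, $r_0=p$, $g_0=0$). Let $u=\min\{t\in\mathbb N: g_t\notin\mathrm{Ap}(H,m_0)\}$ and $v=\min\{b\ge1: bn\in H'\}$. It is known (Patil–Singh) that there are unique integers $z\in[0,u-1]$, $w\in[0,v-1]$, $\lambda\ge1$, $\mu\ge0$ with $g_u=\lambda m_0+wn$, $vn=\mu m_0+g_z$, and $g_{u-z}+(v-w)n=\nu m_0$, where $\nu=\lambda+\mu+1$ if $r_{u-z}<r_u$ and $\nu=\lambda+\mu$ if $r_{u-z}\ge r_u$. Set $r=r_u$, $q=q_u$, $r'=r_{u-z}$, $q'=q_{u-z}$, and $W=[u-z,u-1]\times[v-w,v-1]$ (empty iff $z=0$ or $w=0$). $\mathrm{PF}(H)$ is the set of $f\in\mathbb Z\setminus H$ with $f+h\in H$ for all $h\in H\setminus\{0\}$.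 An $\mathrm{RF}$-matrix for $f\in\mathrm{PF}(H)$ is a $(p+2)\times(p+2)$ integer matrix with rows and columns indexed by $0,1,\dots,p,n$ (corresponding to the generators $m_0,\dots,m_p,n$), with all diagonal entries $-1$, all off-diagonal entries in $\mathbb N$, and such that each row $(b_0,\dots,b_p,b_n)$ satisfies $\sum_{j=0}^p b_jm_j+b_nn=f$. $E_0,\dots,E_p,E_n$ denote the standard basis vectors of $\mathbb Z^{p+2}$ (coordinates indexed by $0,\dots,p,n$). When $W\neq\emptyset$, let $\alpha_i=g_{(q'-1)p+i}+(v-1)n-m_0$ for $i\in I$, where $I=\{p\}$ if $r'=1,q'=0$; $I=[1,p]$ if $r'=1,q'>0$; $I=[p+1,p+r'-1]$ if $r'\ge2$. $\mathrm{PF}_1(H)$ denotes the set of pseudo-Frobenius numbers of $H$ of the form $\alpha_i$, $i\in I$. *)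

theory Defs
  imports Complex_Main "Jordan_Normal_Form.Matrix"
begin

text \<open>Semigroups are sets of integers, so that \<open>h - m\<^sub>0\<close> and pseudo-Frobenius numbers
  are taken in the integers without truncation.\<close>

definition semigroup_gen :: "int set \<Rightarrow> int set" where
  "semigroup_gen A = {\<Sum>a\<in>A. int (c a) * a | c. True}"

definition minimal_generating_set :: "int set \<Rightarrow> int set \<Rightarrow> bool" where
  "minimal_generating_set A H \<longleftrightarrow>
     semigroup_gen A = H \<and> (\<forall>B. B \<subset> A \<longrightarrow> semigroup_gen B \<noteq> H)"

definition Apery :: "int set \<Rightarrow> int \<Rightarrow> int set" where
  "Apery H a = {h \<in> H. h - a \<notin> H}"

definition PF :: "int set \<Rightarrow> int set" where
  "PF H = {f. f \<notin> H \<and> (\<forall>h \<in> H - {0}. f + h \<in> H)}"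

definition arith :: "int \<Rightarrow> int \<Rightarrow> nat \<Rightarrow> int" where
  "arith m0 d i = m0 + int i * d"

definition H_arith :: "nat \<Rightarrow> int \<Rightarrow> int \<Rightarrow> int set" where
  "H_arith p m0 d = semigroup_gen (arith m0 d ` {0..p})"

definition H_almost :: "nat \<Rightarrow> int \<Rightarrow> int \<Rightarrow> int \<Rightarrow> int set" where
  "H_almost p m0 d n = semigroup_gen (insert n (arith m0 d ` {0..p}))"

text \<open>\<open>t = q\<^sub>t p + r\<^sub>t\<close> with \<open>r\<^sub>t \<in> [1,p]\<close> (not \<open>[0,p-1]\<close>), hence the shift by one;
  in particular \<open>q\<^sub>0 = -1\<close> and \<open>r\<^sub>0 = p\<close>.\<close>

definition quo :: "nat \<Rightarrow> nat \<Rightarrow> int" where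
  "quo p t = (int t - 1) div int p"

definition rmd :: "nat \<Rightarrow> nat \<Rightarrow> nat" where
  "rmd p t = nat ((int t - 1) mod int p) + 1"

lemma quo_rmd_iff:
  assumes "p \<ge> 1"
  shows "int t = q * int p + int r \<and> r \<in> {1..p} \<longleftrightarrow> q = quo p t \<and> r = rmd p t"
proof
  assume A: "int t = q * int p + int r \<and> r \<in> {1..p}"
  then have e: "int t - 1 = (int r - 1) + q * int p" and b: "0 \<le> int r - 1" "int r - 1 < int p"
    by auto
  have "(int t - 1) div int p = q" "(int t - 1) mod int p = int r - 1"
    unfolding e using b by auto
  then show "q = quo p t \<and> r = rmd p t"
    using b by (auto simp: quo_def rmd_def)
next
  assume A: "q = quo p t \<and> r = rmd p t"
  have m: "0 \<le> (int t - 1) mod int p" "(int t - 1) mod int p < int p"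
    using assms by auto
  have "int t - 1 = quo p t * int p + (int t - 1) mod int p"
    by (simp add: quo_def)
  with A m show "int t = q * int p + int r \<and> r \<in> {1..p}"
    by (auto simp: rmd_def)
qed

definition gg :: "nat \<Rightarrow> int \<Rightarrow> int \<Rightarrow> nat \<Rightarrow> int" where
  "gg p m0 d t = quo p t * arith m0 d p + arith m0 d (rmd p t)"

definition uu :: "nat \<Rightarrow> int \<Rightarrow> int \<Rightarrow> int \<Rightarrow> nat" where
  "uu p m0 d n = (LEAST t. gg p m0 d t \<notin> Apery (H_almost p m0 d n) m0)"

definition vv :: "nat \<Rightarrow> int \<Rightarrow> int \<Rightarrow> int \<Rightarrow> nat" where
  "vv p m0 d n = (LEAST b. b \<ge> 1 \<and> int b * n \<in> H_arith p m0 d)"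

text \<open>Below, \<open>z < u\<close> and \<open>w < v\<close> are always assumed, so subtraction on naturals does not truncate.\<close>

definition WW :: "nat \<Rightarrow> nat \<Rightarrow> nat \<Rightarrow> nat \<Rightarrow> (nat \<times> nat) set" where
  "WW u v z w = {u - z..u - 1} \<times> {v - w..v - 1}"

definition index_set :: "nat \<Rightarrow> int \<Rightarrow> nat \<Rightarrow> nat set" where
  "index_set p q' r' =
     (if r' = 1 then (if q' = 0 then {p} else {1..p}) else {p + 1..p + r' - 1})"

text \<open>For \<open>i\<close> in the index set, \<open>(q' - 1) p + i \<ge> 0\<close> holds, also if \<open>q' = 0\<close>.\<close>

definition alpha :: "nat \<Rightarrow> int \<Rightarrow> int \<Rightarrow> int \<Rightarrow> nat \<Rightarrow> int \<Rightarrow> nat \<Rightarrow> int" where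
  "alpha p m0 d n v q' i = gg p m0 d (nat ((q' - 1) * int p + int i)) + (int v - 1) * n - m0"

definition PF1 :: "nat \<Rightarrow> int \<Rightarrow> int \<Rightarrow> int \<Rightarrow> nat \<Rightarrow> int \<Rightarrow> nat \<Rightarrow> int set" where
  "PF1 p m0 d n v q' r' = {f \<in> PF (H_almost p m0 d n). \<exists>i \<in> index_set p q' r'. f = alpha p m0 d n v q' i}"

text \<open>Rows and columns are numbered \<open>0, \<dots>, p, p + 1\<close>; the last number stands for the index \<open>n\<close>.\<close>

abbreviation E :: "nat \<Rightarrow> nat \<Rightarrow> int vec" where
  "E p j \<equiv> unit_vec (p + 2) j"

abbreviation En :: "nat \<Rightarrow> int vec" where
  "En p \<equiv> unit_vec (p + 2) (p + 1)"

definition RF_matrix :: "nat \<Rightarrow> int \<Rightarrow> int \<Rightarrow> int \<Rightarrow> int \<Rightarrow> int mat \<Rightarrow> bool" where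
  "RF_matrix p m0 d n f A \<longleftrightarrow>
     A \<in> carrier_mat (p + 2) (p + 2) \<and>
     (\<forall>k < p + 2. A $$ (k, k) = -1) \<and>
     (\<forall>k < p + 2. \<forall>j < p + 2. k \<noteq> j \<longrightarrow> A $$ (k, j) \<ge> 0) \<and>
     (\<forall>k < p + 2. (\<Sum>j = 0..p. A $$ (k, j) * arith m0 d j) + A $$ (k, p + 1) * n = f)"

end

theory Submission imports Defs begin

text \<open>Each row is checked by evaluating it at the generators. The only step that uses more than
  the three given relations is row \<open>n\<close> for \<open>\<mu> = 0\<close>, where \<open>\<theta> + r\<^sub>z \<le> p\<close> is needed.
  Otherwise \<open>\<alpha>\<^sub>i + n = g\<^sub>s - m\<^sub>0\<close> with \<open>s = q' p + \<theta> + z < q' p + r' + z = u\<close>. Then \<open>g\<^sub>s\<close> lies in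
  the Apery set by minimality of \<open>u\<close>, so \<open>\<alpha>\<^sub>i + n \<notin> H\<close>, although \<open>\<alpha>\<^sub>i\<close> is pseudo-Frobenius.\<close>

text \<open>The linear functional sending a coefficient row to the integer it represents. Rows built
  from unit vectors can thus be evaluated term by term.\<close>

definition row_value :: "nat \<Rightarrow> int \<Rightarrow> int \<Rightarrow> int \<Rightarrow> int vec \<Rightarrow> int" where
  "row_value p m0 d n x = (\<Sum>j = 0..p. x $ j * arith m0 d j) + x $ (p + 1) * n"

lemma row_value_add:
  assumes "x \<in> carrier_vec (p + 2)" "y \<in> carrier_vec (p + 2)"
  shows "row_value p m0 d n (x + y) = row_value p m0 d n x + row_value p m0 d n y"
  using assms by (simp add: row_value_def algebra_simps sum.distrib)

lemma row_value_diff: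
  assumes "x \<in> carrier_vec (p + 2)" "y \<in> carrier_vec (p + 2)"
  shows "row_value p m0 d n (x - y) = row_value p m0 d n x - row_value p m0 d n y"
  using assms by (simp add: row_value_def algebra_simps sum_subtractf)

lemma row_value_uminus:
  assumes "x \<in> carrier_vec (p + 2)"
  shows "row_value p m0 d n (- x) = - row_value p m0 d n x"
  using assms by (simp add: row_value_def sum_negf)

lemma row_value_smult:
  assumes "x \<in> carrier_vec (p + 2)"
  shows "row_value p m0 d n (c \<cdot>\<^sub>v x) = c * row_value p m0 d n x"
  using assms by (simp add: row_value_def algebra_simps sum_distrib_left)

lemma row_value_E:
  assumes "k \<le> p"
  shows "row_value p m0 d n (E p k) = arith m0 d k"
proof -
  have "(\<Sum>j = 0..p. E p k $ j * arith m0 d j) = (\<Sum>j = 0..p. if j = k then arith m0 d j else 0)"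
    using assms by (intro sum.cong) auto
  with assms show ?thesis
    by (simp add: row_value_def)
qed

lemma row_value_En: "row_value p m0 d n (En p) = n"
proof -
  have "(\<Sum>j = 0..p. En p $ j * arith m0 d j) = (\<Sum>j = 0..p. 0)"
    by (intro sum.cong) auto
  then show ?thesis
    by (simp add: row_value_def)
qed

text \<open>In simp normal form, where \<open>p + 2\<close> is \<open>Suc (Suc p)\<close>.\<close>

lemmas row_value_simps =
  row_value_add[unfolded add_2_eq_Suc' Suc_eq_plus1[symmetric]]
  row_value_diff[unfolded add_2_eq_Suc' Suc_eq_plus1[symmetric]]
  row_value_uminus[unfolded add_2_eq_Suc' Suc_eq_plus1[symmetric]]
  row_value_smult[unfolded add_2_eq_Suc' Suc_eq_plus1[symmetric]]
  row_value_E[unfolded add_2_eq_Suc' Suc_eq_plus1[symmetric]]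
  row_value_En[unfolded add_2_eq_Suc' Suc_eq_plus1[symmetric]]

text \<open>\<open>RF_matrix\<close> constrains each row separately; this is the condition on a
  single row, so rows may be chosen independently.\<close>

definition RF_row :: "nat \<Rightarrow> int \<Rightarrow> int \<Rightarrow> int \<Rightarrow> int \<Rightarrow> nat \<Rightarrow> int vec \<Rightarrow> bool" where
  "RF_row p m0 d n f k x \<longleftrightarrow> x \<in> carrier_vec (p + 2) \<and> x $ k = -1
     \<and> (\<forall>j < p + 2. k \<noteq> j \<longrightarrow> x $ j \<ge> 0) \<and> row_value p m0 d n x = f"

lemma RF_matrix_of_rows:
  assumes "\<And>k. k < p + 2 \<Longrightarrow> RF_row p m0 d n f k (R k)"
  obtains A where "RF_matrix p m0 d n f A" "\<And>k. k < p + 2 \<Longrightarrow> row A k = R k"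
proof
  let ?A = "mat (p + 2) (p + 2) (\<lambda>(k, j). R k $ j)"
  show "RF_matrix p m0 d n f ?A"
    using assms by (auto simp: RF_matrix_def RF_row_def row_value_def)
  show "row ?A k = R k" if "k < p + 2" for k
    using assms[OF that] that by (auto simp: RF_row_def)
qed

lemma semigroup_gen_superset:
  assumes "finite A" "a \<in> A"
  shows "a \<in> semigroup_gen A"
proof -
  have "a = (\<Sum>x\<in>A. int (if x = a then 1 else 0) * x)"
    using assms by (simp add: if_distrib[of int] if_distrib[of "\<lambda>c. c * _"] cong: if_cong)
  then show ?thesis
    unfolding semigroup_gen_def by (intro CollectI exI conjI TrueI)
qed

lemma gg_eq:
  assumes "p \<ge> 1" "int t = q * int p + int r" "r \<in> {1..p}"
  shows "gg p m0 d t = q * arith m0 d p + arith m0 d r"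
  using quo_rmd_iff[OF assms(1), of t q r] assms by (simp add: gg_def)

lemma gg_diff_notin_H:
  assumes "t < uu p m0 d n"
  shows "gg p m0 d t - m0 \<notin> H_almost p m0 d n"
  using not_less_Least[OF assms[unfolded uu_def]] by (simp add: Apery_def)

text \<open>Remainders lie in \<open>{1..p}\<close>, so \<open>quo p 0 = -1\<close>;
  \<open>t = 0\<close> has to be excluded.\<close>

lemma quo_nonneg:
  assumes "p \<ge> 1" "t \<ge> 1"
  shows "quo p t \<ge> 0"
  using assms by (simp add: quo_def pos_imp_zdiv_nonneg_iff)

theorem proposition4p6:
  fixes p u v z w r r' i \<theta> :: nat
    and m0 d n lam \<mu> \<nu> q' :: int
  assumes "p \<ge> 1" and "d \<ge> 1" and "m0 \<ge> 1" and "n \<ge> 1"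
    and "gcd m0 (gcd d n) = 1"
    and "minimal_generating_set (insert n (arith m0 d ` {0..p})) (H_almost p m0 d n)"
    and "u = uu p m0 d n" and "v = vv p m0 d n"
    and "z < u" and "w < v" and "lam \<ge> 1" and "\<mu> \<ge> 0"
    and "gg p m0 d u = lam * m0 + int w * n"
    and "int v * n = \<mu> * m0 + gg p m0 d z"
    and "r = rmd p u" and "r' = rmd p (u - z)" and "q' = quo p (u - z)"
    and "\<nu> = (if r' < r then lam + \<mu> + 1 else lam + \<mu>)"
    and "gg p m0 d (u - z) + int (v - w) * n = \<nu> * m0"
    and "WW u v z w \<noteq> {}"
    and "r' \<ge> 2"
    and "i \<in> {p + 1..p + r' - 1}"
    and "alpha p m0 d n v q' i \<in> PF1 p m0 d n v q' r'"
    and "i = p + \<theta>"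
  shows "\<exists>A. RF_matrix p m0 d n (alpha p m0 d n v q' i) A
    \<and> row A 0 = - E p 0 + q' \<cdot>\<^sub>v E p p + (int v - 1) \<cdot>\<^sub>v En p + E p \<theta>
    \<and> (\<forall>j \<in> {1..2 * p - i}.
         row A j = - E p j + q' \<cdot>\<^sub>v E p p + (int v - 1) \<cdot>\<^sub>v En p + E p (\<theta> + j))
    \<and> (\<forall>j \<in> {2 * p - i + 1..p}.
         row A j = (\<nu> - 1) \<cdot>\<^sub>v E p 0 - E p j + (int w - 1) \<cdot>\<^sub>v En p + E p (\<theta> + j - r'))
    \<and> row A (p + 1) =
        (if \<mu> > 0
         then (\<mu> - 1) \<cdot>\<^sub>v E p 0 + (q' + quo p z) \<cdot>\<^sub>v E p p - En p + E p \<theta> + E p (rmd p z)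
         else (q' + quo p z) \<cdot>\<^sub>v E p p - En p + E p (\<theta> + rmd p z))"
proof -
  define f where "f = alpha p m0 d n v q' i"
  \<comment> \<open>For \<open>z = 0\<close> or \<open>w = 0\<close> a factor of \<open>WW\<close>
    would be \<open>{u..u - 1}\<close> or \<open>{v..v - 1}\<close>, empty since \<open>u\<close>
    and \<open>v\<close> are positive.\<close>
  have z: "z \<ge> 1" and w: "w \<ge> 1" and v: "v \<ge> 1"
    using \<open>WW u v z w \<noteq> {}\<close> \<open>z < u\<close> \<open>w < v\<close> by (auto simp: WW_def)
  have uz: "int (u - z) = q' * int p + int r'" "r' \<in> {1..p}"
    using quo_rmd_iff[OF \<open>p \<ge> 1\<close>, of "u - z" q' r'] \<open>r' = _\<close> \<open>q' = _\<close> by auto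
  have zz: "int z = quo p z * int p + int (rmd p z)" "rmd p z \<in> {1..p}"
    using quo_rmd_iff[OF \<open>p \<ge> 1\<close>, of z "quo p z" "rmd p z"] by auto
  have q': "q' \<ge> 0" and qz: "quo p z \<ge> 0"
    using quo_nonneg[OF \<open>p \<ge> 1\<close>] \<open>q' = _\<close> z \<open>z < u\<close> by auto
  have \<theta>: "1 \<le> \<theta>" "\<theta> < r'" "\<theta> < p"
    using \<open>i \<in> _\<close> \<open>i = _\<close> uz(2) by auto
  have \<nu>: "\<nu> \<ge> 1"
    using \<open>\<nu> = _\<close> \<open>lam \<ge> 1\<close> \<open>\<mu> \<ge> 0\<close> by auto
  \<comment> \<open>The summand \<open>p\<close> of \<open>i\<close> cancels the \<open>-1\<close>
    in \<open>q' - 1\<close>, so \<open>nat\<close> truncates nothing, and \<open>q'\<close>,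
    \<theta> are the quotient and remainder of the index.\<close>
  have "int (nat ((q' - 1) * int p + int i)) = q' * int p + int \<theta>"
    using q' \<open>i = _\<close> by (simp add: algebra_simps)
  from gg_eq[OF \<open>p \<ge> 1\<close> this] have f:
    "f = q' * arith m0 d p + arith m0 d \<theta> + (int v - 1) * n - m0"
    using \<theta> by (simp add: f_def alpha_def)
  have vn: "int v * n = \<mu> * m0 + quo p z * arith m0 d p + arith m0 d (rmd p z)"
    using \<open>int v * n = _\<close> by (simp add: gg_def)
  have \<nu>m0: "q' * arith m0 d p + arith m0 d r' + (int v - int w) * n = \<nu> * m0"
    using \<open>gg p m0 d (u - z) + _ = _\<close> gg_eq[OF \<open>p \<ge> 1\<close> uz, of m0 d] \<open>w < v\<close>
    by (simp add: of_nat_diff)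
  have le_p: "\<theta> + rmd p z \<le> p" if "\<mu> = 0"
  proof (rule ccontr)
    assume gt: "\<not> \<theta> + rmd p z \<le> p"
    let ?s = "nat (q' * int p) + \<theta> + z"
    \<comment> \<open>A remainder sum above \<open>p\<close> carries 1 into the quotient. On
      generators the carry reads m_\<theta> + m_{r_z} = m_p + m_{\<theta> + r_z - p}.\<close>
    have s: "int ?s = (q' + quo p z + 1) * int p + int (\<theta> + rmd p z - p)"
      using gt zz q' by (simp add: algebra_simps of_nat_diff)
    have "\<theta> + rmd p z - p \<in> {1..p}"
      using gt \<theta> zz(2) by auto
    from gg_eq[OF \<open>p \<ge> 1\<close> s this] have "f + n = gg p m0 d ?s - m0"
      using gt f vn that by (simp add: arith_def algebra_simps of_nat_diff)
    moreover have "?s < u"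
      unfolding of_nat_less_iff[where 'a = int, symmetric]
      using uz(1) \<theta> q' \<open>z < u\<close> by (simp add: of_nat_diff)
    ultimately have "f + n \<notin> H_almost p m0 d n"
      using gg_diff_notin_H[of ?s p m0 d n] \<open>u = _\<close> by simp
    moreover have "n \<in> H_almost p m0 d n"
      unfolding H_almost_def by (rule semigroup_gen_superset) auto
    ultimately show False
      using \<open>alpha p m0 d n v q' i \<in> _\<close> \<open>n \<ge> 1\<close> by (auto simp: PF1_def PF_def f_def)
  qed
  define Rn where "Rn =
    (if \<mu> > 0
     then (\<mu> - 1) \<cdot>\<^sub>v E p 0 + (q' + quo p z) \<cdot>\<^sub>v E p p - En p + E p \<theta> + E p (rmd p z)
     else (q' + quo p z) \<cdot>\<^sub>v E p p - En p + E p (\<theta> + rmd p z))"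
  define R1 where "R1 j = - E p j + q' \<cdot>\<^sub>v E p p + (int v - 1) \<cdot>\<^sub>v En p + E p (\<theta> + j)" for j
  define R2 where "R2 j =
    (\<nu> - 1) \<cdot>\<^sub>v E p 0 - E p j + (int w - 1) \<cdot>\<^sub>v En p + E p (\<theta> + j - r')" for j
  \<comment> \<open>The case \<open>j = 0\<close> is row 0. The value is \<open>f\<close> because
    m_\<theta> - m_0 = m_{\<theta>+j} - m_j. From \<theta> \<ge> 1 follows \<open>j < p\<close>, so
    the \<open>E p p\<close> term misses the diagonal.\<close>
  have R1: "RF_row p m0 d n f j (R1 j)" if "j \<le> p - \<theta>" for j
  proof -
    have "row_value p m0 d n (R1 j) = f"
      using that \<theta> f unfolding R1_def
      by (simp add: row_value_simps) (simp add: arith_def algebra_simps)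
    then show ?thesis
      using that \<theta> q' v unfolding RF_row_def R1_def by auto
  qed
  \<comment> \<open>Now \<theta> + j exceeds \<open>p\<close>, so the third relation trades q' m_p +
    (v-w) n for \<nu> m_0 - m_{r'}. Since \<theta> + j > p \<ge> r', the index \<theta> + j - r' is
    positive; since \<theta> < r', it is below \<open>j\<close> and misses the diagonal.\<close>
  have R2: "RF_row p m0 d n f j (R2 j)" if "p - \<theta> < j" "j \<le> p" for j
  proof -
    have "arith m0 d (\<theta> + j - r') = arith m0 d j + arith m0 d \<theta> - arith m0 d r'"
      using that uz(2) unfolding arith_def by (subst of_nat_diff) (auto simp: algebra_simps)
    then have "row_value p m0 d n (R2 j) = f"
      using that \<theta> f \<nu>m0 unfolding R2_def
      by (simp add: row_value_simps) (simp add: arith_def algebra_simps)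
    then show ?thesis
      using that \<theta> w \<nu> uz(2) unfolding RF_row_def R2_def by auto
  qed
  \<comment> \<open>Substituting for v n in f + n leaves a term -m_0. It lowers \<mu> by one if
    \<mu> > 0; otherwise it is absorbed by m_\<theta> + m_{r_z} - m_0 = m_{\<theta> + r_z}, an
    admissible column by \<open>le_p\<close>.\<close>
  have Rn: "RF_row p m0 d n f (p + 1) Rn"
  proof (cases "\<mu> > 0")
    case True
    then have "row_value p m0 d n Rn = f"
      using \<theta> zz(2) f vn unfolding Rn_def
      by (simp add: row_value_simps) (simp add: arith_def algebra_simps)
    with True show ?thesis
      using \<theta> zz(2) q' qz unfolding RF_row_def Rn_def by auto
  next
    case False
    with \<open>\<mu> \<ge> 0\<close> have "\<mu> = 0" by simp
    with le_p have "row_value p m0 d n Rn = f"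
      using f vn unfolding Rn_def
      by (simp add: row_value_simps) (simp add: arith_def algebra_simps)
    with \<open>\<mu> = 0\<close> le_p show ?thesis
      using q' qz unfolding RF_row_def Rn_def by auto
  qed
  \<comment> \<open>The switch at \<open>p - \<theta>\<close> is the bound \<open>2 * p - i\<close>
    of the statement, as \<open>i = p + \<theta>\<close>.\<close>
  define R where "R k = (if k = p + 1 then Rn else if k \<le> p - \<theta> then R1 k else R2 k)" for k
  have "RF_row p m0 d n f k (R k)" if "k < p + 2" for k
  proof (cases "k \<le> p")
    case True
    then show ?thesis using R1 R2 by (simp add: R_def)
  next
    case False
    with that have "k = p + 1" by simp
    then show ?thesis using Rn by (simp add: R_def)
  qed
  from RF_matrix_of_rows[of p m0 d n f R, OF this] obtain A where
    A: "RF_matrix p m0 d n f A" and rows: "\<And>k. k < p + 2 \<Longrightarrow> row A k = R k" by blast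
  have "row A j = R1 j" if "j \<le> p - \<theta>" for j
  proof -
    from that have "j \<le> p" by linarith
    with that rows show ?thesis by (simp add: R_def)
  qed
  moreover have "2 * p - i = p - \<theta>"
    using \<open>i = _\<close> by simp
  moreover have "row A j = R2 j" if "p - \<theta> < j" "j \<le> p" for j
    using that rows by (simp add: R_def)
  ultimately have "row A 0 = R1 0" "\<forall>j \<in> {1..2 * p - i}. row A j = R1 j"
    "\<forall>j \<in> {2 * p - i + 1..p}. row A j = R2 j" "row A (p + 1) = Rn"
    using rows by (auto simp: R_def)
  with A show ?thesis
    unfolding R1_def R2_def Rn_def f_def by (intro exI[of _ A]) simp
qed

end
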